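(* Every CCC space is a GCC space.
   Context: A topological space $X$ is a GCC space if it cannot be represented as a union of infinitely many of its pairwise disjoint non-empty open subsets. A topological space $X$ is a CCC space if it is a continuous image of a product of a compact space and a connected space, i.e. there exist a compact space $K$, a connected space $C$ and a continuous surjection $f:K\times C\to X$. No separation axioms are assumed; compact means that every open cover has a finite subcover. *)

theory Defs
  imports "HOL-Analysis.Analysis"
begin

definition gcc_space :: "'a topology \<Rightarrow> bool" where
  "gcc_space X \<longleftrightarrow>
     \<not> (\<exists>\<U>. infinite \<U> \<and> (\<forall>U\<in>\<U>. openin X U \<and> U \<noteq> {}) \<and> pairwise disjnt \<U>
            \<and> \<Union>\<U> = topspace X)"

text \<open>
  HOL cannot quantify existentially over types, so the types of the points of the compact and the
  connected factor are parameters. A theorem that assumes \<open>ccc_space TYPE('k) TYPE('c) X\<close> with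
  type variables \<open>'k\<close> and \<open>'c\<close> covers factors of arbitrary types. As in the library, the empty
  space counts as connected.
\<close>

definition ccc_space :: "'k itself \<Rightarrow> 'c itself \<Rightarrow> 'a topology \<Rightarrow> bool" where
  "ccc_space _ _ X \<longleftrightarrow>
     (\<exists>(K :: 'k topology) (C :: 'c topology) f.
        compact_space K \<and> connected_space C \<and>
        continuous_map (prod_topology K C) X f \<and>
        f ` topspace (prod_topology K C) = topspace X)"

end

theory Submission
  imports Defs
begin

text \<open>
  Let \<open>f\<close> map \<open>K \<times> C\<close> continuously onto \<open>X\<close>, and let \<open>\<U>\<close> be a partition of \<open>X\<close> into
  non-empty open sets. A connected set cannot be spread over several members of \<open>\<U>\<close>, so
  each image \<open>f ({k} \<times> C)\<close> lies in one of them: which member \<open>f (k, c)\<close> belongs to depends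
  on \<open>k\<close> only. Hence, for one fixed \<open>c\<^sub>0\<close> in \<open>C\<close>, the compact set \<open>f (K \<times> {c\<^sub>0})\<close> already meets every
  member of \<open>\<U>\<close>. A compact set meets only finitely many members of an open partition, so \<open>\<U>\<close>
  is finite.
\<close>

text \<open>
  A member of an open partition has an open complement, the union of the other members, so it
  cannot split a connected set.
\<close>

lemma connectedin_subset_open_partition_member:
  assumes conn: "connectedin X S"
    and opn: "\<And>V. V \<in> \<U> \<Longrightarrow> openin X V"
    and disj: "pairwise disjnt \<U>"
    and cover: "S \<subseteq> \<Union>\<U>"
    and U: "U \<in> \<U>" "U \<inter> S \<noteq> {}"
  shows "S \<subseteq> U"
proof (rule ccontr)
  let ?R = "\<Union>(\<U> - {U})"
  assume "\<not> S \<subseteq> U"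
  then have "?R \<inter> S \<noteq> {}"
    using cover by blast
  moreover have "U \<inter> ?R = {}"
    using disj U(1) by (auto simp: pairwise_def disjnt_def)
  moreover have "openin X ?R"
    using opn by blast
  moreover have "S \<subseteq> U \<union> ?R"
    using cover by blast
  ultimately show False
    using connectedinD [OF conn opn [OF U(1)]] U(2) by blast
qed

text \<open>
  By disjointness, a finite subcover of the compact set already contains every member of the
  partition that the compact set meets.
\<close>

lemma finite_open_partition_if_compactin_meets_all:
  assumes comp: "compactin X S"
    and opn: "\<And>U. U \<in> \<U> \<Longrightarrow> openin X U"
    and disj: "pairwise disjnt \<U>"
    and cover: "S \<subseteq> \<Union>\<U>"
    and meets: "\<And>U. U \<in> \<U> \<Longrightarrow> U \<inter> S \<noteq> {}"
  shows "finite \<U>"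
proof -
  obtain \<F> where \<F>: "finite \<F>" "\<F> \<subseteq> \<U>" "S \<subseteq> \<Union>\<F>"
    using compactinD [OF comp opn cover] by blast
  have "U \<in> \<F>" if U: "U \<in> \<U>" for U
  proof -
    obtain x V where "x \<in> U" "V \<in> \<F>" "x \<in> V"
      using meets [OF U] \<F>(3) by blast
    then have "U = V"
      using disj U \<F>(2) by (auto simp: pairwise_def disjnt_def)
    with \<open>V \<in> \<F>\<close> show ?thesis by simp
  qed
  then have "\<U> \<subseteq> \<F>" by blast
  then show ?thesis
    using \<F>(1) by (rule finite_subset)
qed

theorem proposition2:
  fixes X :: "'a topology"
  assumes "ccc_space TYPE('k) TYPE('c) X"
  shows "gcc_space X"
proof -
  obtain K :: "'k topology" and C :: "'c topology" and f where
    K: "compact_space K" and C: "connected_space C"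
    and f: "continuous_map (prod_topology K C) X f"
    and surj: "f ` topspace (prod_topology K C) = topspace X"
    using assms unfolding ccc_space_def by blast
  have "finite \<U>"
    if opn: "\<forall>U\<in>\<U>. openin X U \<and> U \<noteq> {}" and disj: "pairwise disjnt \<U>"
      and cover: "\<Union>\<U> = topspace X" for \<U>
  proof (cases "topspace C = {}")
    case True
    \<comment> \<open>Then \<open>X\<close> is empty, and a family of non-empty sets with empty union is empty.\<close>
    then have "\<Union>\<U> = {}"
      using surj cover by simp
    then have "\<U> = {}"
      using opn by blast
    then show ?thesis by simp
  next
    case False
    then obtain c0 where c0: "c0 \<in> topspace C" by blast
    let ?S = "(\<lambda>k. f (k, c0)) ` topspace K"
    have "continuous_map K (prod_topology K C) (\<lambda>k. (k, c0))"
      using c0 by (simp add: continuous_map_pairedI)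
    then have "continuous_map K X (\<lambda>k. f (k, c0))"
      using continuous_map_compose [OF _ f] by (simp add: o_def)
    then have comp: "compactin X ?S"
      using image_compactin K unfolding compact_space_def by blast
    have meets: "U \<inter> ?S \<noteq> {}" if U: "U \<in> \<U>" for U
    proof -
      obtain x where x: "x \<in> U" "x \<in> topspace X"
        using opn U cover by blast
      then have "x \<in> f ` (topspace K \<times> topspace C)"
        using surj by simp
      then obtain k c where kc: "k \<in> topspace K" "c \<in> topspace C" "f (k, c) = x"
        by blast
      let ?T = "(\<lambda>c. f (k, c)) ` topspace C"
      have "continuous_map C (prod_topology K C) (\<lambda>c. (k, c))"
        using kc by (simp add: continuous_map_pairedI)
      then have "continuous_map C X (\<lambda>c. f (k, c))"
        using continuous_map_compose [OF _ f] by (simp add: o_def)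
      then have T: "connectedin X ?T"
        using connectedin_continuous_map_image C by (metis connectedin_topspace)
      have "?T \<subseteq> U"
      proof (rule connectedin_subset_open_partition_member [OF T _ disj _ U])
        show "?T \<subseteq> \<Union>\<U>"
          using connectedin_subset_topspace [OF T] cover by simp
        show "U \<inter> ?T \<noteq> {}"
          using x(1) kc by blast
      qed (use opn in blast)
      then have "f (k, c0) \<in> U"
        using c0 by blast
      then show ?thesis
        using kc(1) by blast
    qed
    have S: "?S \<subseteq> \<Union>\<U>"
      using compactin_subset_topspace [OF comp] cover by simp
    have "openin X U" if "U \<in> \<U>" for U
      using opn that by blast
    then show ?thesis
      using finite_open_partition_if_compactin_meets_all [OF comp _ disj S meets] by simp
  qed
  then show ?thesis
    unfolding gcc_space_def by blast
qed

end
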